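(* Let $k\ge 2$ and $q\ge 1$ be integers, and let $m_{k,q}$ be the minimum, over all Sperner labelings of the vertex set $\Delta_{k,q}\cap\mathbb{Z}^k$, of the number of non-monochromatic simplices of the regular triangulation $\mathcal{T}$ of $\Delta_{k,q}$. Then \[ m_{k,q}\ \le\ q^{k-1}-(q-1)^{k-1}. \]
   Context: $\Delta_{k,q}=\mathrm{Conv}\{(q,0,\dots,0),\dots,(0,\dots,0,q)\}=\{x\in\mathbb{R}^k: x_i\ge 0,\ \sum_i x_i=q\}$, with lattice points $\Delta_{k,q}\cap\mathbb{Z}^k$. Let $R_{k,q}=\{y\in\mathbb{R}^{k-1}: 0\le y_1\le y_2\le\dots\le y_{k-1}\le q\}$ and $W_{k,q}=R_{k,q}\cap\mathbb{Z}^{k-1}$. A permutation $\pi$ of $\{1,\dots,k-1\}$ is consistent with $w\in W_{k,q}$ if $w_i=w_{i+1}$ implies $\pi(i)<\pi(i+1)$. For such $(w,\pi)$ let $\sigma(w,\pi)=\{y\in\mathbb{R}^{k-1}: y_i\ge 0 \text{ for all } i,\ 0\le (y-w)_{\pi(1)}\le\dots\le (y-w)_{\pi(k-1)}\le 1\}$. Let $\phi:R_{k,q}\to\Delta_{k,q}$, $\phi(y_1,\dots,y_{k-1})=(y_1,y_2-y_1,\dots,y_{k-1}-y_{k-2},q-y_{k-1})$. The regular triangulation is $\mathcal{T}=\{\phi(\sigma(w,\pi)) : w\in W_{k,q},\ \pi \text{ consistent with } w\}$; its vertices are the points of $\Delta_{k,q}\cap\mathbb{Z}^k$. A Sperner labeling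 is a map $c:\Delta_{k,q}\cap\mathbb{Z}^k\to\{1,\dots,k\}$ such that $v_i=0$ implies $c(v)\ne i$. A simplex of $\mathcal{T}$ is monochromatic if all its vertices receive the same label, and non-monochromatic otherwise.
   Formalization: Consistency is corrected to require π^{-1}(i)<π^{-1}(i+1) when w_i=w_{i+1}, and only simplices σ(w,π) contained in R_{k,q} are used (so w_{k-1}=q is excluded), since otherwise some σ(w,π) leave the domain of φ. *)

theory Defs
  imports
    "HOL-Analysis.Analysis"
    "HOL-Combinatorics.Permutations"
    "HOL-Library.Function_Algebras"
begin

text \<open>
  Since the dimensions \<open>k\<close> and \<open>k - 1\<close> occur together, a point of \<open>\<real>\<^sup>n\<close> is a function
  \<open>nat \<Rightarrow> real\<close> with coordinates indexed by \<open>1, \<dots>, n\<close> and value \<open>0\<close> at every other index.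
  The pointwise vector space structure makes the library's \<open>convex hull\<close> and
  \<open>extreme_point_of\<close> applicable.
\<close>

instantiation "fun" :: (type, real_vector) real_vector
begin

definition scaleR_fun_def: "scaleR r f = (\<lambda>x. r *\<^sub>R f x)"

instance
  by standard (auto simp: scaleR_fun_def fun_eq_iff scaleR_add_left scaleR_add_right)

end

definition space_n :: "nat \<Rightarrow> (nat \<Rightarrow> real) set" where
  "space_n n = {x. \<forall>i. i \<notin> {1..n} \<longrightarrow> x i = 0}"

definition lattice_n :: "nat \<Rightarrow> (nat \<Rightarrow> real) set" where
  "lattice_n n = {x \<in> space_n n. \<forall>i\<in>{1..n}. x i \<in> \<int>}"

definition Delta :: "nat \<Rightarrow> nat \<Rightarrow> (nat \<Rightarrow> real) set" where
  "Delta k q = convex hull ((\<lambda>j i. if i = j then real q else 0) ` {1..k})"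

definition R :: "nat \<Rightarrow> nat \<Rightarrow> (nat \<Rightarrow> real) set" where
  "R k q = {y \<in> space_n (k - 1). 0 \<le> y 1 \<and> (\<forall>i\<in>{1..<k - 1}. y i \<le> y (i + 1)) \<and> y (k - 1) \<le> real q}"

definition W :: "nat \<Rightarrow> nat \<Rightarrow> (nat \<Rightarrow> real) set" where
  "W k q = R k q \<inter> lattice_n (k - 1)"

text \<open>
  In \<open>sigma\<close> below, \<open>\<pi> 1, \<dots>, \<pi> (k - 1)\<close> lists the coordinates in increasing order of \<open>y - w\<close>.
  Hence, for the simplex to satisfy \<open>y\<^sub>i \<le> y\<^sub>i\<^sub>+\<^sub>1\<close> when \<open>w\<^sub>i = w\<^sub>i\<^sub>+\<^sub>1\<close>, the permutation that has to be
  increasing at \<open>i\<close> is the one giving the position of \<open>i\<close> in this list, the inverse of \<open>\<pi>\<close>.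
\<close>

definition consistent :: "nat \<Rightarrow> (nat \<Rightarrow> real) \<Rightarrow> (nat \<Rightarrow> nat) \<Rightarrow> bool" where
  "consistent k w \<pi> \<longleftrightarrow> \<pi> permutes {1..k - 1} \<and>
     (\<forall>i\<in>{1..<k - 1}. w i = w (i + 1) \<longrightarrow> inv \<pi> i < inv \<pi> (i + 1))"

definition sigma :: "nat \<Rightarrow> (nat \<Rightarrow> real) \<Rightarrow> (nat \<Rightarrow> nat) \<Rightarrow> (nat \<Rightarrow> real) set" where
  "sigma k w \<pi> = {y \<in> space_n (k - 1). (\<forall>i\<in>{1..k - 1}. 0 \<le> y i) \<and>
     0 \<le> (y - w) (\<pi> 1) \<and>
     (\<forall>i\<in>{1..<k - 1}. (y - w) (\<pi> i) \<le> (y - w) (\<pi> (i + 1))) \<and>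
     (y - w) (\<pi> (k - 1)) \<le> 1}"

definition phi :: "nat \<Rightarrow> nat \<Rightarrow> (nat \<Rightarrow> real) \<Rightarrow> (nat \<Rightarrow> real)" where
  "phi k q y = (\<lambda>i. if i = 1 then y 1
                    else if i \<in> {2..k - 1} then y i - y (i - 1)
                    else if i = k then real q - y (k - 1)
                    else 0)"

text \<open>
  The map \<open>\<phi>\<close> has domain \<open>R\<close>, so only simplices inside \<open>R\<close> are taken. This discards precisely
  those \<open>w\<close> with \<open>w\<^sub>k\<^sub>-\<^sub>1 = q\<close>, for which \<open>sigma k w \<pi>\<close> sticks out of \<open>R\<close>.
\<close>

definition triangulation :: "nat \<Rightarrow> nat \<Rightarrow> (nat \<Rightarrow> real) set set" where
  "triangulation k q =
     {phi k q ` sigma k w \<pi> | w \<pi>. w \<in> W k q \<and> consistent k w \<pi> \<and> sigma k w \<pi> \<subseteq> R k q}"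

definition sperner_labeling :: "nat \<Rightarrow> nat \<Rightarrow> ((nat \<Rightarrow> real) \<Rightarrow> nat) \<Rightarrow> bool" where
  "sperner_labeling k q c \<longleftrightarrow>
     (\<forall>v \<in> Delta k q \<inter> lattice_n k. c v \<in> {1..k} \<and> (\<forall>i\<in>{1..k}. v i = 0 \<longrightarrow> c v \<noteq> i))"

definition monochromatic :: "((nat \<Rightarrow> real) \<Rightarrow> nat) \<Rightarrow> (nat \<Rightarrow> real) set \<Rightarrow> bool" where
  "monochromatic c S \<longleftrightarrow> (\<exists>l. \<forall>v. v extreme_point_of S \<longrightarrow> c v = l)"

definition num_nonmono :: "nat \<Rightarrow> nat \<Rightarrow> ((nat \<Rightarrow> real) \<Rightarrow> nat) \<Rightarrow> nat" where
  "num_nonmono k q c = card {S \<in> triangulation k q. \<not> monochromatic c S}"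

definition min_nonmono :: "nat \<Rightarrow> nat \<Rightarrow> nat" where
  "min_nonmono k q = Inf {num_nonmono k q c | c. sperner_labeling k q c}"


text \<open>
  The next facts confirm that the infimum and the cardinality above are not degenerate.
\<close>

lemma sum_fun_apply: "sum f A x = (\<Sum>a\<in>A. f a x)"
  by (induction A rule: infinite_finite_induct) auto

lemma Delta_eq:
  assumes "q \<ge> 1"
  shows "Delta k q = {x \<in> space_n k. (\<forall>i\<in>{1..k}. 0 \<le> x i) \<and> (\<Sum>i=1..k. x i) = real q}"
proof -
  let ?e = "\<lambda>j i::nat. if i = j then real q else 0"
  have inj: "inj_on ?e {1..k}"
    using assms by (auto simp: inj_on_def fun_eq_iff split: if_splits)
  have ap: "(\<Sum>j=1..k. u j *\<^sub>R ?e j) i = (if i \<in> {1..k} then u i * real q else 0)" for u :: "nat \<Rightarrow> real" and i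
  proof -
    have "(\<Sum>j=1..k. u j *\<^sub>R ?e j) i = (\<Sum>j=1..k. if i = j then u j * real q else 0)"
      unfolding sum_fun_apply scaleR_fun_def by (intro sum.cong) auto
    then show ?thesis by (simp add: sum.delta)
  qed
  have D: "Delta k q = {\<Sum>j=1..k. u j *\<^sub>R ?e j | u. (\<forall>j\<in>{1..k}. 0 \<le> u j) \<and> sum u {1..k} = 1}"
  proof -
    have "x \<in> Delta k q \<longleftrightarrow> (\<exists>u. (\<forall>j\<in>{1..k}. 0 \<le> u j) \<and> sum u {1..k} = 1 \<and> x = (\<Sum>j=1..k. u j *\<^sub>R ?e j))" for x
    proof
      assume "x \<in> Delta k q"
      then obtain v where v: "\<forall>x\<in>?e ` {1..k}. 0 \<le> v x" "sum v (?e ` {1..k}) = 1"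
          "(\<Sum>x\<in>?e ` {1..k}. v x *\<^sub>R x) = x"
        unfolding Delta_def by (subst (asm) convex_hull_finite) auto
      show "\<exists>u. (\<forall>j\<in>{1..k}. 0 \<le> u j) \<and> sum u {1..k} = 1 \<and> x = (\<Sum>j=1..k. u j *\<^sub>R ?e j)"
        using v(1) v(2,3)[unfolded sum.reindex[OF inj] o_def]
        by (intro exI[of _ "\<lambda>j. v (?e j)"]) auto
    next
      assume "\<exists>u. (\<forall>j\<in>{1..k}. 0 \<le> u j) \<and> sum u {1..k} = 1 \<and> x = (\<Sum>j=1..k. u j *\<^sub>R ?e j)"
      then obtain u where u: "\<forall>j\<in>{1..k}. 0 \<le> u j" "sum u {1..k} = 1" "x = (\<Sum>j=1..k. u j *\<^sub>R ?e j)"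
        by blast
      show "x \<in> Delta k q"
        unfolding u(3) Delta_def using u(1,2)
        by (intro convex_sum convex_convex_hull) (auto intro: hull_inc)
    qed
    then show ?thesis by blast
  qed
  show ?thesis
  proof (intro equalityI subsetI)
    fix x assume "x \<in> Delta k q"
    then obtain u where u: "\<forall>j\<in>{1..k}. 0 \<le> u j" "sum u {1..k} = 1" "x = (\<Sum>j=1..k. u j *\<^sub>R ?e j)"
      unfolding D by blast
    have "x i = (if i \<in> {1..k} then u i * real q else 0)" for i
      unfolding u(3) by (rule ap)
    then show "x \<in> {x \<in> space_n k. (\<forall>i\<in>{1..k}. 0 \<le> x i) \<and> (\<Sum>i=1..k. x i) = real q}"
      using u(1,2) by (auto simp: space_n_def sum_distrib_right[symmetric])
  next
    fix x assume x: "x \<in> {x \<in> space_n k. (\<forall>i\<in>{1..k}. 0 \<le> x i) \<and> (\<Sum>i=1..k. x i) = real q}"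
    have "x = (\<Sum>j=1..k. (x j / real q) *\<^sub>R ?e j)"
    proof
      fix i
      show "x i = (\<Sum>j=1..k. (x j / real q) *\<^sub>R ?e j) i"
        unfolding ap using x assms by (auto simp: space_n_def)
    qed
    moreover have "(\<Sum>j=1..k. x j / real q) = 1"
      using x assms by (simp add: sum_divide_distrib[symmetric])
    ultimately show "x \<in> Delta k q"
      unfolding D using x by (intro CollectI exI[of _ "\<lambda>j. x j / real q"]) auto
  qed
qed

lemma sperner_labeling_exists:
  assumes "q \<ge> 1"
  shows "\<exists>c. sperner_labeling k q c"
proof -
  have "\<exists>l\<in>{1..k}. v l \<noteq> 0" if "v \<in> Delta k q" for v
  proof (rule ccontr)
    assume "\<not> ?thesis"
    then have "(\<Sum>i=1..k. v i) = 0" by simp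
    then show False using that assms by (simp add: Delta_eq)
  qed
  then have "\<forall>v. \<exists>l. v \<in> Delta k q \<longrightarrow> l \<in> {1..k} \<and> v l \<noteq> 0" by blast
  then obtain c where "\<forall>v. v \<in> Delta k q \<longrightarrow> c v \<in> {1..k} \<and> v (c v) \<noteq> 0" by metis
  then show ?thesis
    unfolding sperner_labeling_def by (intro exI[of _ c]) auto
qed

lemma min_nonmono_attained:
  assumes "q \<ge> 1"
  shows "\<exists>c. sperner_labeling k q c \<and> min_nonmono k q = num_nonmono k q c"
proof -
  have "min_nonmono k q \<in> {num_nonmono k q c | c. sperner_labeling k q c}"
    unfolding min_nonmono_def using sperner_labeling_exists[OF assms, of k]
    by (intro Inf_nat_def1) auto
  then show ?thesis by auto
qed

lemma min_nonmono_le: "sperner_labeling k q c \<Longrightarrow> min_nonmono k q \<le> num_nonmono k q c"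
  unfolding min_nonmono_def by (auto intro: cInf_lower)

lemma finite_W: "finite (W k q)"
proof -
  have bd: "0 \<le> y i \<and> y i \<le> real q" if y: "y \<in> R k q" and i: "i \<in> {1..k - 1}" for y i
  proof
    have "1 \<le> i" "i \<le> k - 1" using i by auto
    show "0 \<le> y i" using \<open>1 \<le> i\<close> \<open>i \<le> k - 1\<close>
    proof (induction i rule: dec_induct)
      case base then show ?case using y by (simp add: R_def)
    next
      case (step n)
      then have "y n \<le> y (n + 1)" using \<open>y \<in> R k q\<close> by (simp add: R_def)
      then show ?case using step by simp
    qed
    show "y i \<le> real q" using \<open>i \<le> k - 1\<close> \<open>1 \<le> i\<close>
    proof (induction i rule: inc_induct)
      case base then show ?case using y by (simp add: R_def)
    next
      case (step n)
      then have "y n \<le> y (n + 1)" using \<open>y \<in> R k q\<close> by (simp add: R_def)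
      then show ?case using step by simp
    qed
  qed
  have "W k q \<subseteq> {f. \<forall>i. (i \<in> {1..k - 1} \<longrightarrow> f i \<in> real ` {..q}) \<and> (i \<notin> {1..k - 1} \<longrightarrow> f i = 0)}"
  proof
    fix w assume w: "w \<in> W k q"
    have "w i \<in> real ` {..q}" if i: "i \<in> {1..k - 1}" for i
    proof -
      have "w i \<in> \<int>" using w i by (simp add: W_def lattice_n_def)
      moreover have "0 \<le> w i" "w i \<le> real q" using bd w i by (auto simp: W_def)
      ultimately show ?thesis
        by (auto elim!: Ints_cases intro!: image_eqI[of _ _ "nat \<lfloor>w i\<rfloor>"] simp: nat_le_iff)
    qed
    then show "w \<in> {f. \<forall>i. (i \<in> {1..k - 1} \<longrightarrow> f i \<in> real ` {..q}) \<and> (i \<notin> {1..k - 1} \<longrightarrow> f i = 0)}"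
      using w by (auto simp: W_def R_def space_n_def)
  qed
  then show ?thesis
    by (rule finite_subset) (intro finite_set_of_finite_funs; simp)
qed

lemma finite_triangulation: "finite (triangulation k q)"
proof -
  have "triangulation k q \<subseteq>
      (\<lambda>(w, \<pi>). phi k q ` sigma k w \<pi>) ` (W k q \<times> {\<pi>. \<pi> permutes {1..k - 1}})"
    unfolding triangulation_def consistent_def by auto
  then show ?thesis
    by (rule finite_subset) (intro finite_imageI finite_cartesian_product finite_W finite_permutations; simp)
qed

end

theory Submission
  imports Defs
begin

text \<open>
  Label a vertex by \<open>1\<close> whenever its first coordinate is nonzero, and arbitrarily (subject to the
  Sperner condition) otherwise. The simplex given by \<open>(w, \<pi>)\<close> is then monochromatic unless
  \<open>w\<^sub>1 = 0\<close>. Consistency says that \<open>\<pi>\<inverse>\<close> is the stable sorting permutation of the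
  word \<open>f = w \<circ> \<pi>\<close>, so that \<open>(w, \<pi>)\<close> can be recovered from \<open>f\<close>. A non-monochromatic simplex thus
  gives a word of length \<open>k - 1\<close> over \<open>{0, \<dots>, q - 1}\<close> containing the letter \<open>0\<close>, and there are
  \<open>q\<^sup>k\<^sup>-\<^sup>1 - (q - 1)\<^sup>k\<^sup>-\<^sup>1\<close> of these.
\<close>

lemma chain_mono:
  fixes f :: "nat \<Rightarrow> 'a::order"
  assumes "\<And>i. i \<in> {1..<n} \<Longrightarrow> f i \<le> f (i + 1)" and "1 \<le> i" "i \<le> j" "j \<le> n"
  shows "f i \<le> f j"
  using \<open>i \<le> j\<close> \<open>j \<le> n\<close>
proof (induction j rule: dec_induct)
  case (step m)
  have "f m \<le> f (m + 1)" using step.hyps step.prems assms(2) by (intro assms(1)) auto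
  with step show ?case by (auto intro: order_trans)
qed simp

lemma R_mono: "y \<in> R k q \<Longrightarrow> 1 \<le> i \<Longrightarrow> i \<le> j \<Longrightarrow> j \<le> k - 1 \<Longrightarrow> y i \<le> y j"
  by (rule chain_mono[of "k - 1" y]) (auto simp: R_def)

lemma R_nonneg: "y \<in> R k q \<Longrightarrow> i \<in> {1..k - 1} \<Longrightarrow> 0 \<le> y i"
  using R_mono[of y k q 1 i] by (auto simp: R_def)

text \<open>\<open>consistent\<close> compares neighbours only, and only where \<open>w\<close> has
  a tie. As \<open>w\<close> is weakly increasing, each step from \<open>i\<close> to
  \<open>i + 1\<close> strictly increases the pair \<open>(w i, inv \<pi> i)\<close>
  lexicographically, and transitivity does the rest. The claim is strict, so the induction on
  \<open>b\<close> starts at \<open>a + 1\<close>.\<close>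

lemma consistent_lex:
  assumes w: "w \<in> R k q" and c: "consistent k w \<pi>"
    and ab: "1 \<le> a" "a < b" "b \<le> k - 1"
  shows "w a < w b \<or> w a = w b \<and> inv \<pi> a < inv \<pi> b"
  using \<open>a < b\<close>[THEN Suc_leI] \<open>b \<le> k - 1\<close>
proof (induction b rule: dec_induct)
  case base
  have "w a \<le> w (a + 1)" using R_mono[OF w, of a "a + 1"] ab by auto
  moreover have "w a = w (a + 1) \<longrightarrow> inv \<pi> a < inv \<pi> (a + 1)"
    using c ab unfolding consistent_def by auto
  ultimately show ?case by auto
next
  case (step m)
  have "w m \<le> w (m + 1)" using R_mono[OF w, of m "m + 1"] step ab by auto
  moreover have "w m = w (m + 1) \<longrightarrow> inv \<pi> m < inv \<pi> (m + 1)"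
    using c ab step unfolding consistent_def by auto
  ultimately show ?case using step by auto
qed

text \<open>The right-hand side depends only on the word \<open>w \<circ> \<pi>\<close> and the
  positions \<open>i\<close>, \<open>j\<close>: values of \<open>\<pi>\<close> are ordered by their
  letters, ties by position. Trichotomy reduces both directions to \<open>consistent_lex\<close> at
  \<open>\<pi> i\<close> and \<open>\<pi> j\<close>.\<close>

lemma consistent_le_iff:
  assumes w: "w \<in> R k q" and c: "consistent k w \<pi>"
    and ij: "i \<in> {1..k - 1}" "j \<in> {1..k - 1}"
  shows "\<pi> i \<le> \<pi> j \<longleftrightarrow> w (\<pi> i) < w (\<pi> j) \<or> w (\<pi> i) = w (\<pi> j) \<and> i \<le> j"
proof -
  have p: "\<pi> permutes {1..k - 1}" using c by (simp add: consistent_def)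
  have lex: "w (\<pi> i) < w (\<pi> j) \<or> w (\<pi> i) = w (\<pi> j) \<and> i < j"
    if "i \<in> {1..k - 1}" "j \<in> {1..k - 1}" "\<pi> i < \<pi> j" for i j
  proof -
    have "\<pi> i \<in> {1..k - 1}" "\<pi> j \<in> {1..k - 1}" using that p by (simp_all only: permutes_in_image)
    then show ?thesis
      using consistent_lex[OF w c, of "\<pi> i" "\<pi> j"] that(3) permutes_inverses(2)[OF p] by simp
  qed
  consider "\<pi> i < \<pi> j" | "\<pi> j < \<pi> i" | "i = j"
    using inj_eq[OF permutes_inj[OF p], of i j] by linarith
  then show ?thesis
    using lex[of i j] lex[of j i] ij by cases auto
qed

text \<open>The rank of a value among \<open>1, ..., n\<close> is the value itself, so a permutation
  is determined by the comparisons between its values.\<close>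

lemma card_permutes_le:
  assumes p: "\<pi> permutes {1..n}" and j: "j \<in> {1..n}"
  shows "card {i \<in> {1..n}. \<pi> i \<le> \<pi> j} = \<pi> j"
proof -
  have "\<pi> j \<le> n" using permutes_in_image[OF p, of j] j by auto
  moreover have "\<pi> ` {i \<in> {1..n}. \<pi> i \<le> \<pi> j} = {x \<in> \<pi> ` {1..n}. x \<le> \<pi> j}"
    by blast
  ultimately have img: "\<pi> ` {i \<in> {1..n}. \<pi> i \<le> \<pi> j} = {1..\<pi> j}"
    unfolding permutes_image[OF p] by auto
  have "inj_on \<pi> {i \<in> {1..n}. \<pi> i \<le> \<pi> j}"
    using permutes_inj[OF p] by (rule inj_on_subset) simp
  from card_image[OF this] show ?thesis unfolding img by simp
qed

text \<open>Equal words give equal comparisons by \<open>consistent_le_iff\<close>, hence equal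
  ranks and equal permutations. Then \<open>w\<close> is the common word composed with
  \<open>inv \<pi>\<close>.\<close>

lemma consistent_word_inj:
  assumes w: "w \<in> R k q" "consistent k w \<pi>" and w': "w' \<in> R k q'" "consistent k w' \<pi>'"
    and eq: "\<And>j. j \<in> {1..k - 1} \<Longrightarrow> w (\<pi> j) = w' (\<pi>' j)"
  shows "w = w' \<and> \<pi> = \<pi>'"
proof -
  have p: "\<pi> permutes {1..k - 1}" and p': "\<pi>' permutes {1..k - 1}"
    using w w' by (simp_all add: consistent_def)
  have "\<pi> j = \<pi>' j" for j
  proof (cases "j \<in> {1..k - 1}")
    case True
    have "{i \<in> {1..k - 1}. \<pi> i \<le> \<pi> j} = {i \<in> {1..k - 1}. \<pi>' i \<le> \<pi>' j}"
      using True by (intro Collect_cong) (auto simp: consistent_le_iff[OF w] consistent_le_iff[OF w'] eq)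
    then show ?thesis
      using card_permutes_le[OF p True] card_permutes_le[OF p' True] by simp
  next
    case False
    then show ?thesis using p p' by (simp add: permutes_not_in)
  qed
  then have "\<pi> = \<pi>'" ..
  moreover have "w i = w' i" for i
  proof (cases "i \<in> {1..k - 1}")
    case True
    then have "inv \<pi> i \<in> {1..k - 1}"
      using permutes_in_image[OF permutes_inv[OF p]] by blast
    from eq[OF this] show ?thesis using \<open>\<pi> = \<pi>'\<close> permutes_inverses(1)[OF p] by simp
  next
    case False
    then show ?thesis using w w' by (simp add: R_def space_n_def)
  qed
  ultimately show ?thesis by auto
qed

lemma sigma_subset_R_imp_less:
  assumes k: "k \<ge> 2" and w: "w \<in> R k q" and p: "\<pi> permutes {1..k - 1}"
    and sub: "sigma k w \<pi> \<subseteq> R k q" and i: "i \<in> {1..k - 1}"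
  shows "w i + 1 \<le> real q"
proof -
  \<comment> \<open>The corner of the simplex farthest from \<open>w\<close>: all relevant
    coordinates of \<open>y - w\<close> equal 1, so every ordering condition in \<open>sigma\<close>
    holds. Its last coordinate, the largest, must still be at most \<open>q\<close>.\<close>
  define y where "y = (\<lambda>i. if i \<in> {1..k - 1} then w i + 1 else 0)"
  have "y (\<pi> j) = w (\<pi> j) + 1" if "j \<in> {1..k - 1}" for j
    using permutes_in_image[OF p, of j] that by (simp add: y_def)
  moreover have "0 \<le> y j" for j using R_nonneg[OF w] by (simp add: y_def)
  moreover have "y \<in> space_n (k - 1)" by (simp add: space_n_def y_def)
  ultimately have "y \<in> sigma k w \<pi>"
    using k by (simp add: sigma_def)
  then have "y (k - 1) \<le> real q" using sub by (auto simp: R_def)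
  moreover have "w i \<le> w (k - 1)" using i by (intro R_mono[OF w]) auto
  moreover have "y (k - 1) = w (k - 1) + 1" using k by (simp add: y_def)
  ultimately show ?thesis by linarith
qed

lemma sigma_ge:
  assumes p: "\<pi> permutes {1..k - 1}" and y: "y \<in> sigma k w \<pi>" and i: "i \<in> {1..k - 1}"
  shows "w i \<le> y i"
proof -
  \<comment> \<open>The position of coordinate \<open>i\<close> in the list
    \<open>\<pi> 1, ..., \<pi> (k - 1)\<close>, along which \<open>y - w\<close> increases from a
    nonnegative start.\<close>
  let ?j = "inv \<pi> i"
  have "?j \<in> {1..k - 1}" using i permutes_in_image[OF permutes_inv[OF p]] by blast
  then have "(y - w) (\<pi> 1) \<le> (y - w) (\<pi> ?j)"
    using y by - (rule chain_mono[of "k - 1" "\<lambda>j. (y - w) (\<pi> j)"], auto simp: sigma_def)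
  moreover have "0 \<le> (y - w) (\<pi> 1)" using y by (simp add: sigma_def)
  ultimately show ?thesis using permutes_inverses(1)[OF p] by simp
qed

text \<open>Every point \<open>y\<close> of \<open>sigma k w \<pi>\<close> has
  \<open>y 1 \<ge> w 1\<close>, and \<open>phi\<close> keeps the first coordinate. An extreme point
  belongs to its set, so every vertex has a positive first coordinate and gets the label
  \<open>l\<close>.\<close>

lemma monochromatic_if_w1_pos:
  assumes k: "k \<ge> 2" and p: "\<pi> permutes {1..k - 1}" and w: "w 1 > 0"
    and c: "\<And>v. v 1 \<noteq> 0 \<Longrightarrow> c v = l"
  shows "monochromatic c (phi k q ` sigma k w \<pi>)"
proof -
  have "c v = l" if "v extreme_point_of (phi k q ` sigma k w \<pi>)" for v
  proof -
    obtain y where y: "y \<in> sigma k w \<pi>" "v = phi k q y"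
      using \<open>v extreme_point_of _\<close> by (auto simp: extreme_point_of_def)
    have "w 1 \<le> y 1" using sigma_ge[OF p y(1), of 1] k by simp
    then show ?thesis using w y(2) by (intro c) (simp add: phi_def)
  qed
  then show ?thesis by (auto simp: monochromatic_def)
qed

lemma sperner_labeling_first:
  assumes "k \<ge> 1" "q \<ge> 1"
  shows "\<exists>c. sperner_labeling k q c \<and> (\<forall>v. v 1 \<noteq> 0 \<longrightarrow> c v = 1)"
proof -
  obtain c where "sperner_labeling k q c" using sperner_labeling_exists[OF assms(2)] by blast
  \<comment> \<open>Overwriting by 1 keeps the Sperner condition, as the label 1 is forbidden only
    where \<open>v 1 = 0\<close>.\<close>
  then have "sperner_labeling k q (\<lambda>v. if v 1 \<noteq> 0 then 1 else c v)"
    using assms(1) by (auto simp: sperner_labeling_def)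
  then show ?thesis by (intro exI conjI) auto
qed

lemma W_word_range:
  assumes k: "k \<ge> 2" and w: "w \<in> W k q" and p: "\<pi> permutes {1..k - 1}"
    and sub: "sigma k w \<pi> \<subseteq> R k q" and i: "i \<in> {1..k - 1}"
  shows "w i \<in> real ` {..<q}"
proof -
  have wR: "w \<in> R k q" and "w i \<in> \<int>" using w i by (auto simp: W_def lattice_n_def)
  then obtain m where m: "w i = of_int m" by (auto elim: Ints_cases)
  have "0 \<le> w i" by (rule R_nonneg[OF wR i])
  moreover have "w i + 1 \<le> real q" by (rule sigma_subset_R_imp_less[OF k wR p sub i])
  ultimately have "0 \<le> m" "nat m < q" unfolding m by linarith+
  then show ?thesis using m by (intro image_eqI[of _ _ "nat m"]) auto
qed

lemma card_words_with_zero: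
  "int (card (({1..n} \<rightarrow>\<^sub>E real ` {..<q}) - ({1..n} \<rightarrow>\<^sub>E real ` {1..<q}))) =
    int q ^ n - int (q - 1) ^ n"
proof -
  have sub: "({1..n} \<rightarrow>\<^sub>E real ` {1..<q}) \<subseteq> ({1..n} \<rightarrow>\<^sub>E real ` {..<q})"
    by (intro PiE_mono) auto
  have fin: "finite ({1..n} \<rightarrow>\<^sub>E real ` {1..<q})" "finite ({1..n} \<rightarrow>\<^sub>E real ` {..<q})"
    by (intro finite_PiE; simp)+
  have "card ({1..n} \<rightarrow>\<^sub>E real ` {..<q}) = q ^ n"
    and "card ({1..n} \<rightarrow>\<^sub>E real ` {1..<q}) = (q - 1) ^ n"
    by (simp_all add: card_PiE card_image)
  then show ?thesis
    using card_Diff_subset[OF fin(1) sub] card_mono[OF fin(2) sub] by simp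
qed

theorem theorem1p2:
  fixes k q :: nat
  assumes "k \<ge> 2" and "q \<ge> 1"
  shows "int (min_nonmono k q) \<le> int q ^ (k - 1) - (int q - 1) ^ (k - 1)"
proof -
  obtain c where c: "sperner_labeling k q c" "\<And>v. v 1 \<noteq> 0 \<Longrightarrow> c v = 1"
    using sperner_labeling_first[of k q] assms by auto
  define P where "P = {(w, \<pi>). w \<in> W k q \<and> consistent k w \<pi> \<and> sigma k w \<pi> \<subseteq> R k q \<and> w 1 = 0}"
  \<comment> \<open>\<open>restrict\<close> makes the word an extensional function, so that words
    can be counted inside a \<open>PiE\<close> set.\<close>
  define word where "word = (\<lambda>(w :: nat \<Rightarrow> real, \<pi> :: nat \<Rightarrow> nat). restrict (w \<circ> \<pi>) {1..k - 1})"
  let ?F = "({1..k - 1} \<rightarrow>\<^sub>E real ` {..<q}) - ({1..k - 1} \<rightarrow>\<^sub>E real ` {1..<q})"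
  have finF: "finite ?F" by (intro finite_Diff finite_PiE) auto
  have inj: "inj_on word P"
  proof (rule inj_onI, clarify)
    fix w \<pi> w' \<pi>' assume P: "(w, \<pi>) \<in> P" "(w', \<pi>') \<in> P" and eq: "word (w, \<pi>) = word (w', \<pi>')"
    have "w (\<pi> j) = w' (\<pi>' j)" if "j \<in> {1..k - 1}" for j
      using fun_cong[OF eq, of j] that by (simp add: word_def)
    then show "w = w' \<and> \<pi> = \<pi>'"
      using P by (intro consistent_word_inj[of w k q \<pi> w' q \<pi>']) (auto simp: P_def W_def)
  qed
  have range: "word ` P \<subseteq> ?F"
  proof (rule image_subsetI)
    fix x assume "x \<in> P"
    then obtain w \<pi> where x: "x = (w, \<pi>)" and w: "w \<in> W k q"
      and p: "\<pi> permutes {1..k - 1}" and sub: "sigma k w \<pi> \<subseteq> R k q" and w1: "w 1 = 0"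
      by (auto simp: P_def consistent_def)
    have "\<pi> i \<in> {1..k - 1}" if "i \<in> {1..k - 1}" for i
      using that by (simp only: permutes_in_image[OF p])
    then have "word (w, \<pi>) \<in> {1..k - 1} \<rightarrow>\<^sub>E real ` {..<q}"
      using W_word_range[OF assms(1) w p sub] by (auto simp: word_def restrict_PiE_iff)
    moreover have "word (w, \<pi>) \<notin> {1..k - 1} \<rightarrow>\<^sub>E real ` {1..<q}"
    proof
      assume *: "word (w, \<pi>) \<in> {1..k - 1} \<rightarrow>\<^sub>E real ` {1..<q}"
      \<comment> \<open>At position \<open>inv \<pi> 1\<close> the word has the letter
        \<open>w 1 = 0\<close>.\<close>
      have "inv \<pi> 1 \<in> {1..k - 1}"
        using permutes_in_image[OF permutes_inv[OF p], of 1] assms(1) by simp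
      then have "w (\<pi> (inv \<pi> 1)) \<in> real ` {1..<q}"
        using PiE_mem[OF *] by (simp add: word_def)
      then show False using permutes_inverses(1)[OF p] w1 by auto
    qed
    ultimately show "word x \<in> ?F" unfolding x by blast
  qed
  \<comment> \<open>Covering by \<open>P\<close> suffices for an upper bound: the pairs are counted,
    through their words, in place of the simplices.\<close>
  have cover: "{S \<in> triangulation k q. \<not> monochromatic c S} \<subseteq> (\<lambda>(w, \<pi>). phi k q ` sigma k w \<pi>) ` P"
  proof clarify
    fix S assume S: "S \<in> triangulation k q" "\<not> monochromatic c S"
    then obtain w \<pi> where wp: "S = phi k q ` sigma k w \<pi>" "w \<in> W k q" "consistent k w \<pi>"
        "sigma k w \<pi> \<subseteq> R k q"
      by (auto simp: triangulation_def)
    have "\<not> w 1 > 0"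
      using monochromatic_if_w1_pos[of k \<pi> w c 1] wp S(2) assms(1) c(2) by (auto simp: consistent_def)
    moreover have "0 \<le> w 1" using wp(2) by (simp add: W_def R_def)
    ultimately show "S \<in> (\<lambda>(w, \<pi>). phi k q ` sigma k w \<pi>) ` P"
      using wp by (intro image_eqI[of _ _ "(w, \<pi>)"]) (auto simp: P_def)
  qed
  have "finite P"
    using finite_imageD[OF finite_subset[OF range finF] inj] .
  then have "num_nonmono k q c \<le> card P"
    unfolding num_nonmono_def using cover by (rule surj_card_le)
  also have "card P \<le> card ?F"
    using card_inj_on_le[OF inj range finF] .
  finally have "min_nonmono k q \<le> card ?F"
    using min_nonmono_le[OF c(1)] by simp
  then have "int (min_nonmono k q) \<le> int q ^ (k - 1) - int (q - 1) ^ (k - 1)"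
    using card_words_with_zero[of "k - 1" q] by linarith
  \<comment> \<open>Here \<open>q \<ge> 1\<close> turns the truncated \<open>int (q - 1)\<close>
    into \<open>int q - 1\<close>.\<close>
  then show ?thesis using assms(2) by simp
qed

end
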